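(* Let $1\le D<2$ be given. Then for every integer $m$ with $1\le m<\omega$ there is an integer $n$ with $1\le n<\omega$ such that for all ordinals $\alpha<\omega_1$ the space $C([0,\omega^\alpha\cdot n])$ does not embed into the space $C([0,\omega^\alpha\cdot m])$ with distortion $D$.
   Context: For an ordinal $\beta$, $C([0,\beta])$ is the Banach space of continuous real-valued functions on the ordinal interval $[0,\beta]$ (order topology) with the supremum norm; $\omega^\alpha\cdot n$ uses ordinal arithmetic. A mapping $f:M\to N$ between metric spaces $(M,d)$ and $(N,\rho)$ is a Lipschitz embedding if there are constants $C_1,C_2>0$ with $C_1d(x,y)\le\rho(f(x),f(y))\le C_2d(x,y)$ for all $x,y\in M$; its distortion $\operatorname{dist}(f)$ is the infimum of $C_2/C_1$ over all such constants. $M$ embeds into $N$ with distortion $D$ if there is a (not necessarily linear) Lipschitz embedding $f:M\to N$ with $\operatorname{dist}(f)\le D$. *)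

theory Defs
  imports "HOL-Analysis.Analysis"
begin

section \<open>Ordinals as well-orders\<close>

unbundle cardinal_syntax

text \<open>
  An ordinal is represented by a reflexive relation \<open>r\<close> with \<^term>\<open>Well_order r\<close>, two such relations
  being the same ordinal if they are isomorphic (\<^term>\<open>(r, s) \<in> ordIso\<close>), and \<open>r <o s\<close> being the strict order of
  ordinals.  The empty relation is the ordinal 0, \<^term>\<open>natLeq_on n\<close> is the finite ordinal \<open>n\<close>,
  \<^term>\<open>natLeq\<close> is \<open>\<omega>\<close>, and \<^term>\<open>cardSuc natLeq\<close> is \<open>\<omega>\<^sub>1\<close>.
\<close>

text \<open>
  Ordinal product: \<open>s\<close> copies of \<open>r\<close> one after the other, i.e. the second component is the most
  significant one.
\<close>

definition ord_mult :: "'a rel \<Rightarrow> 'b rel \<Rightarrow> ('a \<times> 'b) rel" where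
  "ord_mult r s = {((x, i), (y, j)). x \<in> Field r \<and> y \<in> Field r \<and> i \<in> Field s \<and> j \<in> Field s \<and>
      (((i, j) \<in> s \<and> i \<noteq> j) \<or> (i = j \<and> (x, y) \<in> r))}"

text \<open>The successor ordinal \<open>r + 1\<close>; \<^const>\<open>None\<close> is the new largest element.\<close>

definition ord_succ :: "'a rel \<Rightarrow> 'a option rel" where
  "ord_succ r = {(Some x, Some y) | x y. (x, y) \<in> r} \<union> {(u, None) | u. u \<in> insert None (Some ` Field r)}"

text \<open>
  The ordinal power \<open>\<omega>\<^sup>r\<close>: a function \<open>f\<close> with finite support in \<open>r\<close> stands for the Cantor normal form
  that sums the terms \<open>\<omega>\<^sup>x \<cdot> f x\<close> in decreasing order of the exponents \<open>x\<close>, and two such functions are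
  compared at the largest argument where they differ.  The recursion equations of ordinal
  exponentiation are derived below.
\<close>

definition omega_pow :: "'a rel \<Rightarrow> ('a \<Rightarrow> nat) rel" where
  "omega_pow r =
    (let F = {f. finite {x. f x \<noteq> 0} \<and> {x. f x \<noteq> 0} \<subseteq> Field r}
     in {(f, g). f \<in> F \<and> g \<in> F \<and>
          (f = g \<or> (\<exists>x \<in> Field r. f x < g x \<and> (\<forall>y \<in> aboveS r x. f y = g y)))})"


section \<open>The spaces of continuous functions\<close>

text \<open>
  The order topology of a linear order given by \<open>r\<close>.  The whole field is added to the open rays since
  these do not cover a one-point order.
\<close>

definition rel_order_topology :: "'a rel \<Rightarrow> 'a topology" where
  "rel_order_topology r =
    topology_generated_by (insert (Field r) (underS r ` Field r \<union> aboveS r ` Field r))"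

text \<open>
  The interval \<open>[0, \<beta>]\<close> is the set of ordinals below \<open>\<beta> + 1\<close>.  The elements of \<^const>\<open>cfunspace\<close> are the
  bounded continuous functions (extended by \<^const>\<open>undefined\<close> outside the space), and its metric is
  the supremum metric; boundedness is no restriction here because \<open>[0, \<beta>]\<close> is compact.
\<close>

definition C_interval :: "'a rel \<Rightarrow> ('a option \<Rightarrow> real) metric" where
  "C_interval \<beta> = cfunspace (rel_order_topology (ord_succ \<beta>)) euclidean_metric"


section \<open>Lipschitz embeddings and distortion\<close>

definition lipschitz_bounds :: "'a metric \<Rightarrow> 'b metric \<Rightarrow> ('a \<Rightarrow> 'b) \<Rightarrow> real \<Rightarrow> real \<Rightarrow> bool" where
  "lipschitz_bounds M N f C1 C2 \<longleftrightarrow> 0 < C1 \<and> 0 < C2 \<and>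
    (\<forall>x \<in> mspace M. \<forall>y \<in> mspace M.
       C1 * mdist M x y \<le> mdist N (f x) (f y) \<and> mdist N (f x) (f y) \<le> C2 * mdist M x y)"

definition lipschitz_embedding :: "'a metric \<Rightarrow> 'b metric \<Rightarrow> ('a \<Rightarrow> 'b) \<Rightarrow> bool" where
  "lipschitz_embedding M N f \<longleftrightarrow>
    f \<in> mspace M \<rightarrow> mspace N \<and> (\<exists>C1 C2. lipschitz_bounds M N f C1 C2)"

definition distortion :: "'a metric \<Rightarrow> 'b metric \<Rightarrow> ('a \<Rightarrow> 'b) \<Rightarrow> real" where
  "distortion M N f = Inf {C2 / C1 | C1 C2. lipschitz_bounds M N f C1 C2}"

definition embeds_with_distortion :: "'a metric \<Rightarrow> 'b metric \<Rightarrow> real \<Rightarrow> bool" where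
  "embeds_with_distortion M N D \<longleftrightarrow> (\<exists>f. lipschitz_embedding M N f \<and> distortion M N f \<le> D)"


section \<open>Basic facts\<close>

text \<open>Every countable ordinal is represented by a well-order of a set of natural numbers.\<close>

lemma countable_ordinal_on_nat:
  assumes "(r :: 'a rel) <o cardSuc natLeq"
  shows "\<exists>s :: nat rel. (s, r) \<in> ordIso \<and> s <o cardSuc natLeq"
proof -
  have W: "Well_order r" using assms by (simp add: ordLess_def)
  have "|Field r| \<le>o r"
    using W by (simp add: card_of_least)
  hence "|Field r| <o cardSuc natLeq"
    using assms ordLeq_ordLess_trans by blast
  hence "|Field r| \<le>o natLeq"
    using cardSuc_ordLeq_ordLess[OF natLeq_Card_order card_of_Card_order] by blast
  hence "|Field r| \<le>o |UNIV :: nat set|"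
    using card_of_nat ordIso_symmetric ordLeq_ordIso_trans by blast
  then obtain f :: "'a \<Rightarrow> nat" where f: "inj_on f (Field r)"
    using card_of_ordLeq[of "Field r" "UNIV :: nat set"] by auto
  have "(r, dir_image r f) \<in> ordIso" using dir_image_ordIso[OF W f] .
  thus ?thesis by (metis assms ordIso_symmetric ordIso_ordLess_trans)
qed

lemma Well_orderI:
  assumes "\<And>x. x \<in> Field r \<Longrightarrow> (x, x) \<in> r" "trans r" "antisym r"
    and "\<And>x y. \<lbrakk>x \<in> Field r; y \<in> Field r; x \<noteq> y\<rbrakk> \<Longrightarrow> (x, y) \<in> r \<or> (y, x) \<in> r"
    and "wf (r - Id)"
  shows "Well_order r"
  using assms
  by (auto simp: well_order_on_def linear_order_on_def partial_order_on_def preorder_on_def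
      refl_on_def total_on_def Field_def)

lemma Well_orderD:
  assumes "Well_order r"
  shows "\<And>x. x \<in> Field r \<Longrightarrow> (x, x) \<in> r" "trans r" "antisym r"
    and "\<And>x y. \<lbrakk>x \<in> Field r; y \<in> Field r\<rbrakk> \<Longrightarrow> (x, y) \<in> r \<or> (y, x) \<in> r"
    and "wf (r - Id)"
proof -
  show "\<And>x. x \<in> Field r \<Longrightarrow> (x, x) \<in> r" "trans r" "antisym r" "wf (r - Id)"
    using assms
    by (auto simp: well_order_on_def linear_order_on_def partial_order_on_def preorder_on_def
        refl_on_def)
  then show "\<And>x y. \<lbrakk>x \<in> Field r; y \<in> Field r\<rbrakk> \<Longrightarrow> (x, y) \<in> r \<or> (y, x) \<in> r"
    using assms unfolding well_order_on_def linear_order_on_def total_on_def by metis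
qed

lemma Field_ord_mult:
  assumes "Well_order r" "Well_order s"
  shows "Field (ord_mult r s) = Field r \<times> Field s"
proof -
  have "((x, i), (x, i)) \<in> ord_mult r s" if "x \<in> Field r" "i \<in> Field s" for x i
    using that Well_orderD(1)[OF assms(1)] by (auto simp: ord_mult_def)
  thus ?thesis by (fastforce simp: ord_mult_def Field_def)
qed

lemma Well_order_ord_mult:
  assumes r: "Well_order r" and s: "Well_order s"
  shows "Well_order (ord_mult r s)"
proof (rule Well_orderI)
  note R = Well_orderD[OF r] and S = Well_orderD[OF s]
  show "(p, p) \<in> ord_mult r s" if "p \<in> Field (ord_mult r s)" for p
    using that R(1) unfolding Field_ord_mult[OF r s] by (auto simp: ord_mult_def)
  show "trans (ord_mult r s)"
    unfolding trans_def ord_mult_def using transD[OF R(2)] transD[OF S(2)] antisymD[OF S(3)]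
    by (clarsimp) blast
  show "antisym (ord_mult r s)"
    unfolding antisym_def ord_mult_def using antisymD[OF R(3)] antisymD[OF S(3)] by auto
  show "(p, q) \<in> ord_mult r s \<or> (q, p) \<in> ord_mult r s"
    if "p \<in> Field (ord_mult r s)" "q \<in> Field (ord_mult r s)" "p \<noteq> q" for p q
    using that R(4) S(4) unfolding Field_ord_mult[OF r s] by (auto simp: ord_mult_def)
  have "ord_mult r s - Id \<subseteq> inv_image ((s - Id) <*lex*> (r - Id)) (\<lambda>(x, i). (i, x))"
    by (auto simp: ord_mult_def)
  thus "wf (ord_mult r s - Id)"
    using R(5) S(5) wf_subset wf_inv_image wf_lex_prod by metis
qed

lemma Field_ord_succ: "Field (ord_succ r) = insert None (Some ` Field r)" (is "_ = ?F")
proof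
  show "Field (ord_succ r) \<subseteq> ?F"
    by (auto simp: ord_succ_def Field_def)
  have "(u, None) \<in> ord_succ r" if "u \<in> ?F" for u
    using that by (simp add: ord_succ_def)
  thus "?F \<subseteq> Field (ord_succ r)"
    by (meson FieldI1 subsetI)
qed

lemma Well_order_ord_succ:
  assumes r: "Well_order r"
  shows "Well_order (ord_succ r)"
proof (rule Well_orderI)
  note R = Well_orderD[OF r]
  show "(u, u) \<in> ord_succ r" if "u \<in> Field (ord_succ r)" for u
    using that R(1) unfolding Field_ord_succ by (auto simp: ord_succ_def)
  show "trans (ord_succ r)"
    unfolding trans_def ord_succ_def using transD[OF R(2)] by (auto simp: Field_def)
  show "antisym (ord_succ r)"
    unfolding antisym_def ord_succ_def using antisymD[OF R(3)] by auto
  show "(u, v) \<in> ord_succ r \<or> (v, u) \<in> ord_succ r"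
    if "u \<in> Field (ord_succ r)" "v \<in> Field (ord_succ r)" "u \<noteq> v" for u v
    proof -
    have "\<exists>x y. u = Some x \<and> v = Some y \<and> x \<in> Field r \<and> y \<in> Field r"
      if "u \<noteq> None" "v \<noteq> None"
      using that \<open>u \<in> Field (ord_succ r)\<close> \<open>v \<in> Field (ord_succ r)\<close>
      unfolding Field_ord_succ by auto
    thus ?thesis
      using that R(4) unfolding Field_ord_succ by (cases u; cases v) (auto simp: ord_succ_def)
  qed
  let ?g = "\<lambda>u. case u of None \<Rightarrow> (1::nat, undefined) | Some x \<Rightarrow> (0, x)"
  have "ord_succ r - Id \<subseteq> inv_image (less_than <*lex*> (r - Id)) ?g"
    by (auto simp: ord_succ_def)
  thus "wf (ord_succ r - Id)"
    using R(5) wf_subset wf_inv_image wf_lex_prod wf_less_than by metis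
qed

lemma Field_omega_pow: "Field (omega_pow r) = {f. finite {x. f x \<noteq> 0} \<and> {x. f x \<noteq> 0} \<subseteq> Field r}"
  by (auto simp: omega_pow_def Field_def)

lemma omega_pow_iff:
  "(f, g) \<in> omega_pow r \<longleftrightarrow> f \<in> Field (omega_pow r) \<and> g \<in> Field (omega_pow r) \<and>
     (f = g \<or> (\<exists>x \<in> Field r. f x < g x \<and> (\<forall>y \<in> aboveS r x. f y = g y)))"
  unfolding Field_omega_pow by (auto simp: omega_pow_def)

lemma Well_order_omega_pow:
  assumes r: "Well_order r"
  shows "Well_order (omega_pow r)"
proof (rule Well_orderI)
  note R = Well_orderD[OF r]
  let ?L = "\<lambda>f g x. x \<in> Field r \<and> f x < (g x :: nat) \<and> (\<forall>y \<in> aboveS r x. f y = g y)"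
  show "(f, f) \<in> omega_pow r" if "f \<in> Field (omega_pow r)" for f
    using that by (simp add: omega_pow_iff)
  have L_trans: "\<exists>z. ?L f h z" if x: "?L f g x" and y: "?L g h y" for f g h x y
  proof -
    consider "x = y" | "x \<noteq> y" "(x, y) \<in> r" | "x \<noteq> y" "(y, x) \<in> r"
      using R(4) x y by blast
    thus ?thesis
    proof cases
      case 1
      hence "?L f h x" using x y by auto
      thus ?thesis by blast
    next
      case 2
      hence "aboveS r y \<subseteq> aboveS r x" "y \<in> aboveS r x"
        using transD[OF R(2)] antisymD[OF R(3)] by (auto simp: aboveS_def)
      hence "?L f h y" using x y by auto
      thus ?thesis by blast
    next
      case 3
      hence "aboveS r x \<subseteq> aboveS r y" "x \<in> aboveS r y"
        using transD[OF R(2)] antisymD[OF R(3)] by (auto simp: aboveS_def)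
      hence "?L f h x" using x y by auto
      thus ?thesis by blast
    qed
  qed
  show "trans (omega_pow r)"
  proof (rule transI)
    fix f g h assume "(f, g) \<in> omega_pow r" "(g, h) \<in> omega_pow r"
    thus "(f, h) \<in> omega_pow r"
      using L_trans[where f = f and g = g and h = h] unfolding omega_pow_iff by blast
  qed
  show "antisym (omega_pow r)"
  proof (rule antisymI)
    fix f g assume "(f, g) \<in> omega_pow r" "(g, f) \<in> omega_pow r"
    thus "f = g"
      using L_trans[where f = f and g = g and h = f] unfolding omega_pow_iff by blast
  qed
  show "(f, g) \<in> omega_pow r \<or> (g, f) \<in> omega_pow r"
    if f: "f \<in> Field (omega_pow r)" and g: "g \<in> Field (omega_pow r)" and "f \<noteq> g" for f g
  proof -
    let ?D = "{x. f x \<noteq> g x}"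
    have sub: "?D \<subseteq> {x. f x \<noteq> 0} \<union> {x. g x \<noteq> 0}" by auto
    have fin: "finite ?D" using f g finite_subset[OF sub] by (simp add: Field_omega_pow)
    have D: "?D \<subseteq> Field r" using f g sub by (auto simp: Field_omega_pow)
    have "?D \<noteq> {}" using \<open>f \<noteq> g\<close> by auto
    have "\<exists>x \<in> A. \<forall>y \<in> A. (y, x) \<in> r" if "finite A" "A \<noteq> {}" "A \<subseteq> Field r" for A
      using that
    proof (induction A rule: finite_ne_induct)
      case (singleton x)
      thus ?case using R(1) by auto
    next
      case (insert a A)
      then obtain x where x: "x \<in> A" "\<forall>y \<in> A. (y, x) \<in> r" by auto
      show ?case
      proof (cases "(a, x) \<in> r")
        case True
        thus ?thesis using x by auto
      next
        case False
        moreover have "x \<in> Field r" "a \<in> Field r" using x(1) insert.prems by auto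
        ultimately have "(x, a) \<in> r" "(a, a) \<in> r" using R(4)[of x a] R(1)[of a] by auto
        thus ?thesis using x transD[OF R(2)] by blast
      qed
    qed
    then obtain x where x: "f x \<noteq> g x" "\<And>y. f y \<noteq> g y \<Longrightarrow> (y, x) \<in> r"
      using fin D \<open>?D \<noteq> {}\<close> by (metis (mono_tags, lifting) mem_Collect_eq)
    have "f y = g y" if "y \<in> aboveS r x" for y
      using x(2) that antisymD[OF R(3)] by (auto simp: aboveS_def)
    moreover have "x \<in> Field r" using x(1) D by auto
    ultimately show ?thesis
      using f g x(1) unfolding omega_pow_iff by (metis linorder_neqE_nat)
  qed
  have "omega_pow r - Id \<subseteq> inv_image (mult (r - Id)) Abs_multiset"
  proof (rule subrelI)
    fix f g assume "(f, g) \<in> omega_pow r - Id"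
    hence fg: "(f, g) \<in> omega_pow r" "(f, g) \<notin> Id" by auto
    let ?F = "Abs_multiset f" and ?G = "Abs_multiset g"
    have F: "count ?F = f" and G: "count ?G = g"
      using fg by (auto simp: omega_pow_iff Field_omega_pow)
    obtain x where x: "?L f g x" using fg unfolding omega_pow_iff by auto
    have supp: "{x. f x \<noteq> 0} \<subseteq> Field r" using fg by (simp add: omega_pow_iff Field_omega_pow)
    have xJ: "x \<in># ?G - ?F" using x by (simp add: in_diff_count F G)
    have "(k, x) \<in> r - Id" if "k \<in># ?F - ?G" for k
    proof -
      have k: "g k < f k" using that by (simp add: in_diff_count F G)
      hence "k \<in> Field r" using supp by auto
      moreover have "k \<noteq> x" "k \<notin> aboveS r x" using k x by auto
      ultimately show ?thesis using x R(4) by (auto simp: aboveS_def)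
    qed
    hence "(?F \<inter># ?G + (?F - ?G), ?F \<inter># ?G + (?G - ?F)) \<in> mult (r - Id)"
      using xJ by (intro one_step_implies_mult) auto
    moreover have "?F \<inter># ?G + (?F - ?G) = ?F" "?F \<inter># ?G + (?G - ?F) = ?G"
      by (auto simp: multiset_eq_iff)
    ultimately show "(f, g) \<in> inv_image (mult (r - Id)) Abs_multiset" by simp
  qed
  thus "wf (omega_pow r - Id)"
    using wf_subset wf_inv_image wf_mult[OF R(5)] by metis
qed

text \<open>The recursion for ordinal powers: \<open>\<omega>\<^sup>0 = 1\<close>, \<open>\<omega>\<^sup>r\<^sup>+\<^sup>1 = \<omega>\<^sup>r \<cdot> \<omega>\<close>, and \<open>\<omega>\<^sup>r = sup\<^sub>s\<^sub><\<^sub>r \<omega>\<^sup>s\<close> for limit \<open>r\<close>.\<close>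

lemma omega_pow_zero: "omega_pow {} = {(\<lambda>_. 0, \<lambda>_. 0)}"
  by (auto simp: omega_pow_def)

lemma omega_pow_succ:
  assumes r: "Well_order r"
  shows "(omega_pow (ord_succ r), ord_mult (omega_pow r) natLeq) \<in> ordIso"
proof -
  note W = Well_order_omega_pow[OF r]
  let ?h = "\<lambda>f :: 'a option \<Rightarrow> nat. (f \<circ> Some, f None)"
  let ?k = "\<lambda>(g :: 'a \<Rightarrow> nat, n) u. case u of None \<Rightarrow> n | Some x \<Rightarrow> g x"
  have above: "aboveS (ord_succ r) (Some x) = insert None (Some ` aboveS r x)" if "x \<in> Field r" for x
    using that by (auto simp: aboveS_def ord_succ_def)
  have above_None: "aboveS (ord_succ r) None = {}"
    by (auto simp: aboveS_def ord_succ_def)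
  have supp: "{u. f u \<noteq> 0} = Some ` {x. (f \<circ> Some) x \<noteq> 0} \<union> (if f None = 0 then {} else {None})"
    for f :: "'a option \<Rightarrow> nat"
  proof (rule set_eqI)
    show "u \<in> {u. f u \<noteq> 0} \<longleftrightarrow>
        u \<in> Some ` {x. (f \<circ> Some) x \<noteq> 0} \<union> (if f None = 0 then {} else {None})" for u
      by (cases u) auto
  qed
  have Field_iff: "f \<in> Field (omega_pow (ord_succ r)) \<longleftrightarrow> f \<circ> Some \<in> Field (omega_pow r)" for f
    unfolding Field_omega_pow Field_ord_succ mem_Collect_eq supp[of f]
    by (auto simp: finite_image_iff)
  have "bij_betw ?h (Field (omega_pow (ord_succ r))) (Field (omega_pow r) \<times> UNIV)"
  proof (rule bij_betw_byWitness[where f' = ?k])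
    show "\<forall>f \<in> Field (omega_pow (ord_succ r)). ?k (?h f) = f"
      by (auto simp: fun_eq_iff split: option.splits)
    show "\<forall>p \<in> Field (omega_pow r) \<times> UNIV. ?h (?k p) = p"
      by (auto simp: fun_eq_iff)
    show "?h ` Field (omega_pow (ord_succ r)) \<subseteq> Field (omega_pow r) \<times> UNIV"
      using Field_iff by auto
    show "?k ` (Field (omega_pow r) \<times> UNIV) \<subseteq> Field (omega_pow (ord_succ r))"
      unfolding image_subset_iff Field_iff by (auto simp: comp_def)
  qed
  moreover have "(f, g) \<in> omega_pow (ord_succ r) \<longleftrightarrow> (?h f, ?h g) \<in> ord_mult (omega_pow r) natLeq"
    if f: "f \<in> Field (omega_pow (ord_succ r))" and g: "g \<in> Field (omega_pow (ord_succ r))" for f g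
  proof -
    have eq: "f = g \<longleftrightarrow> f None = g None \<and> f \<circ> Some = g \<circ> Some"
      unfolding fun_eq_iff using option.exhaust by (metis comp_apply)
    have "(f, g) \<in> omega_pow (ord_succ r) \<longleftrightarrow> f = g \<or> f None < g None \<or>
        f None = g None \<and>
        (\<exists>x \<in> Field r. f (Some x) < g (Some x) \<and> (\<forall>y \<in> aboveS r x. f (Some y) = g (Some y)))"
      unfolding omega_pow_iff[of _ _ "ord_succ r"] using f g
      by (simp add: Field_ord_succ above above_None cong: bex_cong) blast
    also have "\<dots> \<longleftrightarrow> f None < g None \<or> f None = g None \<and> (f \<circ> Some, g \<circ> Some) \<in> omega_pow r"
      unfolding omega_pow_iff[of _ _ r] eq using f g Field_iff by simp blast
    also have "\<dots> \<longleftrightarrow> (?h f, ?h g) \<in> ord_mult (omega_pow r) natLeq"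
      unfolding ord_mult_def using f g Field_iff by (auto simp: natLeq_def Field_def)
    finally show ?thesis .
  qed
  ultimately have "iso (omega_pow (ord_succ r)) (ord_mult (omega_pow r) natLeq) ?h"
    unfolding iso_iff2 Field_ord_mult[OF W natLeq_Well_order] Field_natLeq by blast
  thus ?thesis
    unfolding ordIso_def
    using Well_order_omega_pow[OF Well_order_ord_succ[OF r]]
      Well_order_ord_mult[OF W natLeq_Well_order] by blast
qed

lemma Field_Restr_underS:
  assumes "Well_order r"
  shows "Field (Restr r (underS r a)) = underS r a"
  using Well_orderD(1)[OF assms] by (force simp: Field_def underS_def)

lemma omega_pow_initial_segment:
  assumes r: "Well_order r" and a: "a \<in> Field r"
  defines "s \<equiv> Restr r (underS r a)"
  shows "omega_pow s = Restr (omega_pow r) (Field (omega_pow s))"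
    and "wo_rel.ofilter (omega_pow r) (Field (omega_pow s))"
proof -
  note R = Well_orderD[OF r]
  have Fs: "Field s = underS r a" using Field_Restr_underS[OF r] by (simp add: s_def)
  have sub: "underS r a \<subseteq> Field r" by (auto simp: underS_def Field_def)
  have Fsub: "Field (omega_pow s) \<subseteq> Field (omega_pow r)"
    using sub by (auto simp: Field_omega_pow Fs)
  have out: "f y = 0" if "f \<in> Field (omega_pow s)" "y \<notin> underS r a" for f y
    using that by (auto simp: Field_omega_pow Fs)
  have aboveS_s: "aboveS s x = aboveS r x \<inter> underS r a" if "x \<in> underS r a" for x
    using that by (auto simp: aboveS_def s_def)
  show "omega_pow s = Restr (omega_pow r) (Field (omega_pow s))"
  proof (rule set_eqI, clarify)
    fix f g
    have "(\<exists>x \<in> Field s. f x < g x \<and> (\<forall>y \<in> aboveS s x. f y = g y)) \<longleftrightarrow>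
          (\<exists>x \<in> Field r. f x < g x \<and> (\<forall>y \<in> aboveS r x. f y = g y))" (is "?l \<longleftrightarrow> ?r")
      if f: "f \<in> Field (omega_pow s)" and g: "g \<in> Field (omega_pow s)"
    proof
      assume ?l
      then obtain x where x: "x \<in> underS r a" "f x < g x" "\<forall>y \<in> aboveS s x. f y = g y"
        by (auto simp: Fs)
      have "f y = g y" if "y \<in> aboveS r x" for y
        using that x(1,3) aboveS_s out[OF f] out[OF g] by (cases "y \<in> underS r a") auto
      thus ?r using x sub by blast
    next
      assume ?r
      then obtain x where x: "f x < g x" "\<forall>y \<in> aboveS r x. f y = g y" by auto
      have "x \<in> underS r a" using x(1) out[OF g] by force
      thus ?l using x aboveS_s Fs by auto
    qed
    thus "(f, g) \<in> omega_pow s \<longleftrightarrow> (f, g) \<in> Restr (omega_pow r) (Field (omega_pow s))"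
      using Fsub by (auto simp: omega_pow_iff)
  qed
  have wo: "wo_rel (omega_pow r)"
    using Well_order_omega_pow[OF r] by (simp add: wo_rel_def)
  show "wo_rel.ofilter (omega_pow r) (Field (omega_pow s))"
    unfolding wo_rel.ofilter_def[OF wo]
  proof (intro conjI ballI subsetI)
    show "f \<in> Field (omega_pow r)" if "f \<in> Field (omega_pow s)" for f
      using that Fsub by blast
    fix g f assume g: "g \<in> Field (omega_pow s)" and "f \<in> under (omega_pow r) g"
    hence fg: "(f, g) \<in> omega_pow r" by (simp add: under_def)
    show "f \<in> Field (omega_pow s)"
    proof (cases "f = g")
      case False
      then obtain x where x: "x \<in> Field r" "f x < g x" "\<forall>y \<in> aboveS r x. f y = g y"
        using fg by (auto simp: omega_pow_iff)
      have xa: "x \<in> underS r a" using x(2) out[OF g] by force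
      have zero: "f y = 0" if "y \<notin> underS r a" for y
      proof (cases "y \<in> Field r")
        case True
        hence "(a, y) \<in> r" using that R(4)[OF True a] R(1)[OF a] by (auto simp: underS_def)
        hence "y \<in> aboveS r x" using xa that transD[OF R(2)]
          by (auto simp: aboveS_def underS_def)
        thus ?thesis using x(3) out[OF g that] by simp
      next
        case False
        thus ?thesis using fg by (auto simp: omega_pow_iff Field_omega_pow)
      qed
      have "{y. f y \<noteq> 0} \<subseteq> underS r a"
      proof
        fix y assume "y \<in> {y. f y \<noteq> 0}"
        thus "y \<in> underS r a" using zero[of y] by (cases "y \<in> underS r a") simp_all
      qed
      moreover have "finite {y. f y \<noteq> 0}" using fg unfolding omega_pow_iff Field_omega_pow by blast
      ultimately show ?thesis by (simp add: Field_omega_pow Fs)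
    qed (use g in simp)
  qed
qed

lemma omega_pow_limit:
  assumes r: "Well_order r" and "r \<noteq> {}" and lim: "\<And>a. a \<in> Field r \<Longrightarrow> aboveS r a \<noteq> {}"
  shows "Field (omega_pow r) = (\<Union>a \<in> Field r. Field (omega_pow (Restr r (underS r a))))"
proof -
  note R = Well_orderD[OF r]
  have bound: "\<exists>a \<in> Field r. A \<subseteq> underS r a" if "finite A" "A \<subseteq> Field r" for A
    using that
  proof (induction A rule: finite_induct)
    case empty
    thus ?case using \<open>r \<noteq> {}\<close> by (auto simp: Field_def)
  next
    case (insert x A)
    then obtain a where a: "a \<in> Field r" "A \<subseteq> underS r a" by auto
    obtain b where b: "(x, b) \<in> r" "x \<noteq> b" using lim[of x] insert.prems by (auto simp: aboveS_def)
    have bF: "b \<in> Field r" using b by (auto simp: Field_def)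
    show ?case
    proof (cases "(a, b) \<in> r")
      case True
      hence "underS r a \<subseteq> underS r b"
        using transD[OF R(2)] antisymD[OF R(3)] by (auto simp: underS_def)
      thus ?thesis using a b bF by (auto simp: underS_def)
    next
      case False
      hence "(b, a) \<in> r" using R(4) a bF by blast
      hence "x \<in> underS r a"
        using b transD[OF R(2)] antisymD[OF R(3)] by (auto simp: underS_def)
      thus ?thesis using a by auto
    qed
  qed
  have sub: "underS r a \<subseteq> Field r" for a by (auto simp: underS_def Field_def)
  have iff: "finite A \<and> A \<subseteq> Field r \<longleftrightarrow> (\<exists>a \<in> Field r. finite A \<and> A \<subseteq> underS r a)" for A
    using bound[of A] subset_trans[OF _ sub, of A] by metis
  show ?thesis
    unfolding Field_omega_pow Field_Restr_underS[OF r]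
    by (rule set_eqI, unfold UN_iff mem_Collect_eq, rule iff)
qed

lemma topspace_rel_order_topology: "topspace (rel_order_topology r) = Field r"
  by (auto simp: rel_order_topology_def underS_def aboveS_def Field_def)

end

theory Submission
  imports Defs
begin

text \<open>
  Let \<open>f : C(X) \<rightarrow> C(Y)\<close> have distortion below 2.  For \<open>A \<subseteq> X\<close> let \<open>T A\<close> be the set of all \<open>k \<in> Y\<close> such
  that \<open>f x k - f y k\<close> keeps a fixed sign and stays away from 0 whenever \<open>x\<close> and \<open>y\<close> lie in the ball of
  radius \<open>1/2\<close> and equal \<open>1/2\<close> and \<open>-1/2\<close> on \<open>A\<close>, respectively.  This set is closed and increases with
  \<open>A\<close>.  If \<open>A\<close> is clopen and nonempty, so is \<open>T A\<close>: the indicator functions \<open>1\<^sub>A\<close> and \<open>-1\<^sub>A\<close> have distance 2,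
  all the \<open>x\<close> and \<open>y\<close> are within \<open>1/2\<close> of them, and the distortion is less than 2.  Disjoint clopen
  sets have disjoint \<open>T\<close>, as is seen by testing with constants and with the functions that are
  \<open>1/2\<close> on one set and \<open>-1/2\<close> off it, and vice versa.

  On ordinal intervals it follows by induction on \<open>\<beta>\<close> that \<open>T (p, p + \<omega>\<^sup>\<beta>]\<close> contains a multiple of
  \<open>\<omega>\<^sup>\<beta>\<close>: for \<open>\<gamma> < \<beta>\<close> it contains infinitely many multiples of \<open>\<omega>\<^sup>\<gamma>\<close>, one for each of the intervals
  \<open>(p + \<omega>\<^sup>\<gamma> \<cdot> j, p + \<omega>\<^sup>\<gamma> \<cdot> (j + 1)]\<close>, and it is closed.  For \<open>\<beta> = \<alpha>\<close> the \<open>n\<close> disjoint intervals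
  \<open>(\<omega>\<^sup>\<alpha> \<cdot> i, \<omega>\<^sup>\<alpha> \<cdot> (i + 1)]\<close> yield \<open>n\<close> different multiples of \<open>\<omega>\<^sup>\<alpha>\<close> in \<open>[0, \<omega>\<^sup>\<alpha> \<cdot> m]\<close>, which has only
  \<open>m + 1\<close> of them; so \<open>n = m + 2\<close> will do.
\<close>

section \<open>From the embedding to closed sets of evaluation points\<close>

lemma if_clopen_in_cfunspace:
  assumes "openin X U" "closedin X U"
  shows "(\<lambda>x \<in> topspace X. if x \<in> U then a else b :: real) \<in> mspace (cfunspace X euclidean_metric)"
proof -
  let ?g = "\<lambda>x. if x \<in> U then a else b"
  have "continuous_map X euclidean ?g"
    unfolding continuous_map_def
  proof (intro conjI allI impI)
    fix V
    have "{x \<in> topspace X. ?g x \<in> V} =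
        (if a \<in> V then U else {}) \<union> (if b \<in> V then topspace X - U else {})"
      using openin_subset[OF assms(1)] by auto
    thus "openin X {x \<in> topspace X. ?g x \<in> V}"
      using assms by auto
  qed auto
  hence "continuous_map X euclidean (restrict ?g (topspace X))"
    by (rule continuous_map_eq) simp
  moreover have "bounded (restrict ?g (topspace X) ` topspace X)"
    by (rule finite_imp_bounded, rule finite_subset[of _ "{a, b}"]) auto
  ultimately show ?thesis by (simp del: image_restrict_eq)
qed

text \<open>Collects all that is used of \<open>f\<close>; from here on the argument concerns only
  closed sets of ordinals.\<close>

lemma separating_closed_sets:
  fixes X :: "'a topology" and Y :: "'b topology"
  defines "M \<equiv> cfunspace X (euclidean_metric :: real metric)"
    and "N \<equiv> cfunspace Y (euclidean_metric :: real metric)"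
  assumes f: "f \<in> mspace M \<rightarrow> mspace N" and lip: "lipschitz_bounds M N f C1 C2"
    and C: "C2 < 2 * C1" and X: "topspace X \<noteq> {}" and Y: "topspace Y \<noteq> {}"
  obtains T :: "'a set \<Rightarrow> 'b set" where
    "\<And>A. closedin Y (T A)"
    "\<And>A. \<lbrakk>openin X A; closedin X A; A \<noteq> {}\<rbrakk> \<Longrightarrow> T A \<noteq> {}"
    "\<And>A B. A \<subseteq> B \<Longrightarrow> T A \<subseteq> T B"
    "\<And>A B. \<lbrakk>openin X A; closedin X A; A \<inter> B = {}\<rbrakk> \<Longrightarrow> T A \<inter> T B = {}"
proof -
  \<comment> \<open>At some \<open>k\<close> the images of the functions \<open>a\<close> and
    \<open>b\<close> below differ by more than \<open>2 * C1 - \<delta>\<close>. Replacing them by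
    \<open>x\<close> and \<open>y\<close> costs \<open>C2 / 2\<close> each, and
    \<open>2 * C1 - \<delta> - C2 = \<delta>\<close>.\<close>
  define \<delta> where "\<delta> = (2 * C1 - C2) / 2"
  have \<delta>: "\<delta> > 0" using C by (simp add: \<delta>_def)
  have C2: "C2 > 0" "C1 > 0" using lip by (auto simp: lipschitz_bounds_def)
  have upper: "\<bar>f x k - f y k\<bar> \<le> C2 * b"
    if "x \<in> mspace M" "y \<in> mspace M" "k \<in> topspace Y" "\<And>u. u \<in> topspace X \<Longrightarrow> \<bar>x u - y u\<bar> \<le> b"
    for x y k b
  proof -
    have "mdist M x y \<le> b"
      using that X cfunspace_mdist_le[of x X euclidean_metric y b] unfolding M_def
      by (simp add: dist_real_def)
    hence "mdist N (f x) (f y) \<le> C2 * b"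
      using lip that C2 unfolding lipschitz_bounds_def
      by (meson mult_left_mono order_trans less_imp_le)
    moreover have "f x \<in> mspace N" "f y \<in> mspace N" using f that by auto
    ultimately show ?thesis
      using mdist_cfunspace_imp_mdist_le[of "f x" Y euclidean_metric "f y" "C2 * b" k] that
      unfolding N_def by (simp add: dist_real_def)
  qed
  define P where "P = (\<lambda>A c. {x \<in> mspace M. (\<forall>u \<in> topspace X. \<bar>x u\<bar> \<le> 1/2) \<and>
      (\<forall>u \<in> A \<inter> topspace X. x u = c)})"
  define E where "E = (\<lambda>A \<sigma>. {k \<in> topspace Y. \<forall>x \<in> P A (1/2). \<forall>y \<in> P A (-1/2).
      \<delta> \<le> \<sigma> * (f x k - f y k)})"
  define T where "T = (\<lambda>A. E A 1 \<union> E A (-1))"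
  show ?thesis
  proof
    have "closedin Y (E A \<sigma>)" for A \<sigma>
    proof -
      have "closedin Y {k \<in> topspace Y. \<sigma> * (f x k - f y k) \<in> {\<delta>..}}"
        if "x \<in> P A (1/2)" "y \<in> P A (-1/2)" for x y
      proof (rule closedin_continuous_map_preimage)
        have "f x \<in> mspace N" "f y \<in> mspace N" using that f by (auto simp: P_def)
        thus "continuous_map Y euclidean (\<lambda>k. \<sigma> * (f x k - f y k))"
          unfolding N_def by (intro continuous_intros) auto
      qed simp
      \<comment> \<open>The whole space is inserted to keep the family nonempty even if there are no
        pairs \<open>x\<close>, \<open>y\<close>.\<close>
      hence "closedin Y (\<Inter>(insert (topspace Y) ((\<lambda>(x, y).
          {k \<in> topspace Y. \<sigma> * (f x k - f y k) \<in> {\<delta>..}}) ` (P A (1/2) \<times> P A (-1/2)))))"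
        by (intro closedin_Inter) auto
      also have "\<dots> = E A \<sigma>" by (auto simp: E_def)
      finally show ?thesis .
    qed
    thus "closedin Y (T A)" for A by (simp add: T_def closedin_Un)
  next
    fix A assume A: "openin X A" "closedin X A" "A \<noteq> {}"
    define a where "a = (\<lambda>u \<in> topspace X. if u \<in> A then 1 else 0 :: real)"
    define b where "b = (\<lambda>u \<in> topspace X. if u \<in> A then -1 else 0 :: real)"
    have ab: "a \<in> mspace M" "b \<in> mspace M"
      unfolding a_def b_def M_def using if_clopen_in_cfunspace[OF A(1,2)] by auto
    obtain u where u: "u \<in> A" "u \<in> topspace X" using A openin_subset by blast
    have "2 \<le> dist (a u) (b u)" using u by (simp add: a_def b_def dist_real_def)
    also have "\<dots> \<le> mdist M a b"
      using mdist_cfunspace_imp_mdist_le[of a X euclidean_metric b "mdist M a b" u] ab u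
      unfolding M_def by simp
    finally have "2 * C1 \<le> C1 * mdist M a b" using C2 by simp
    also have "\<dots> \<le> mdist N (f a) (f b)" using lip ab by (auto simp: lipschitz_bounds_def)
    finally have "\<not> mdist N (f a) (f b) \<le> 2 * C1 - \<delta>" using \<delta> by linarith
    moreover have fab: "f a \<in> mspace N" "f b \<in> mspace N" using f ab by auto
    ultimately obtain k where k: "k \<in> topspace Y" "\<bar>f a k - f b k\<bar> > 2 * C1 - \<delta>"
      using cfunspace_mdist_le[of "f a" Y euclidean_metric "f b" "2 * C1 - \<delta>"] Y unfolding N_def
      by (auto simp: dist_real_def)
    have a: "\<bar>f x k - f a k\<bar> \<le> C2 * (1/2)" if "x \<in> P A (1/2)" for x
    proof (rule upper)
      show "\<bar>x u - a u\<bar> \<le> 1/2" if "u \<in> topspace X" for u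
        using that \<open>x \<in> P A (1/2)\<close> by (auto simp: P_def a_def)
    qed (use that ab k in \<open>auto simp: P_def\<close>)
    have b: "\<bar>f y k - f b k\<bar> \<le> C2 * (1/2)" if "y \<in> P A (-1/2)" for y
    proof (rule upper)
      show "\<bar>y u - b u\<bar> \<le> 1/2" if "u \<in> topspace X" for u
        using that \<open>y \<in> P A (-1/2)\<close> by (auto simp: P_def b_def)
    qed (use that ab k in \<open>auto simp: P_def\<close>)
    show "T A \<noteq> {}"
    proof (cases "f a k \<ge> f b k")
      case True
      have "\<delta> \<le> f x k - f y k" if "x \<in> P A (1/2)" "y \<in> P A (-1/2)" for x y
        using a[OF that(1)] b[OF that(2)] True k(2) unfolding \<delta>_def abs_le_iff by argo
      hence "k \<in> T A" using k by (simp add: T_def E_def)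
      thus ?thesis by blast
    next
      case False
      have "\<delta> \<le> - (f x k - f y k)" if "x \<in> P A (1/2)" "y \<in> P A (-1/2)" for x y
        using a[OF that(1)] b[OF that(2)] False k(2) unfolding \<delta>_def abs_le_iff by argo
      hence "k \<in> T A" using k by (simp add: T_def E_def)
      thus ?thesis by blast
    qed
  next
    fix A B :: "'a set" assume "A \<subseteq> B"
    \<comment> \<open>A larger set admits fewer test functions and so imposes fewer conditions on
      \<open>k\<close>.\<close>
    hence "P B c \<subseteq> P A c" for c by (auto simp: P_def)
    thus "T A \<subseteq> T B" by (fastforce simp: T_def E_def)
  next
    fix A B assume AB: "openin X A" "closedin X A" "A \<inter> B = {}"
    define x where "x = (\<lambda>a b. \<lambda>u \<in> topspace X. if u \<in> A then a else b :: real)"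
    have x: "x a b \<in> mspace M" for a b
      unfolding x_def M_def by (rule if_clopen_in_cfunspace[OF AB(1,2)])
    have xA: "x a b \<in> P A a" and xB: "x a b \<in> P B b" if "\<bar>a\<bar> \<le> 1/2" "\<bar>b\<bar> \<le> 1/2" for a b
      using x that AB(3) openin_subset[OF AB(1)] unfolding P_def by (auto simp: x_def)
    have False if "k \<in> E A \<sigma>" "k \<in> E B \<tau>" "\<sigma> = \<tau> \<or> \<sigma> = - \<tau>" for k \<sigma> \<tau>
    proof -
      have "\<delta> \<le> \<sigma> * (f (x (1/2) b) k - f (x (-1/2) c) k)" if "\<bar>b\<bar> \<le> 1/2" "\<bar>c\<bar> \<le> 1/2" for b c
        using \<open>k \<in> E A \<sigma>\<close> xA[of "1/2" b] xA[of "-1/2" c] that by (auto simp: E_def)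
      note A = this[of "1/2" "-1/2"] this[of "-1/2" "1/2"]
      have "\<delta> \<le> \<tau> * (f (x b (1/2)) k - f (x c (-1/2)) k)"
        if "\<bar>b\<bar> \<le> 1/2" "\<bar>c\<bar> \<le> 1/2" for b c
        using \<open>k \<in> E B \<tau>\<close> xB[of b "1/2"] xB[of c "-1/2"] that by (auto simp: E_def)
      note B = this[of "1/2" "-1/2"] this[of "-1/2" "1/2"]
      \<comment> \<open>The constants \<open>1/2\<close> and \<open>-1/2\<close> exclude
        \<open>\<sigma> = - \<tau>\<close>. The two mixed functions exclude
        \<open>\<sigma> = \<tau>\<close>, since the one that is positive on \<open>A\<close> is
        negative on \<open>B\<close>.\<close>
      show False using A B \<delta> that(3) by (auto simp: algebra_simps)
    qed
    thus "T A \<inter> T B = {}" by (force simp: T_def)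
  qed
qed

section \<open>Order topology of a well-order\<close>

text \<open>The complement is an open ray, and the set itself is the open ray below the successor
  \<open>d\<close> of \<open>c\<close>, or everything if \<open>c\<close> is the largest
  element.\<close>

lemma clopen_under:
  assumes r: "Well_order r" and c: "c \<in> Field r"
  shows "openin (rel_order_topology r) (under r c)"
    and "closedin (rel_order_topology r) (under r c)"
proof -
  note R = Well_orderD[OF r]
  have ray: "openin (rel_order_topology r) S"
    if "S \<in> insert (Field r) (underS r ` Field r \<union> aboveS r ` Field r)" for S
    unfolding rel_order_topology_def openin_topology_generated_by_iff
    by (rule generate_topology_on.Basis[OF that])
  have sub: "under r c \<subseteq> Field r" by (auto simp: under_def Field_def)
  have "Field r - under r c = aboveS r c"
    using R(1,4) c antisymD[OF R(3)] FieldI2[of c _ r] by (auto simp: under_def aboveS_def)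
  thus "closedin (rel_order_topology r) (under r c)"
    unfolding closedin_def topspace_rel_order_topology using ray c sub by auto
  show "openin (rel_order_topology r) (under r c)"
  proof (cases "aboveS r c = {}")
    case True
    hence "under r c = Field r" using \<open>Field r - under r c = aboveS r c\<close> sub by auto
    thus ?thesis using ray by auto
  next
    case False
    then obtain d where d: "d \<in> aboveS r c" "\<And>e. (e, d) \<in> r - Id \<Longrightarrow> e \<notin> aboveS r c"
      using R(5) unfolding wf_eq_minimal by blast
    have dF: "d \<in> Field r" using d by (auto simp: aboveS_def Field_def)
    have "underS r d = under r c"
    proof (intro equalityI subsetI)
      fix e assume e: "e \<in> underS r d"
      hence "e \<in> Field r" "e \<notin> aboveS r c" using d(2)[of e] by (auto simp: underS_def Field_def)
      thus "e \<in> under r c" using R(1,4) c by (auto simp: under_def aboveS_def)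
    next
      fix e assume "e \<in> under r c"
      thus "e \<in> underS r d" using d(1) transD[OF R(2)] antisymD[OF R(3)]
        by (auto simp: under_def underS_def aboveS_def)
    qed
    thus ?thesis using ray[of "underS r d"] dF by auto
  qed
qed

text \<open>Induction on the generation of the topology; for an intersection the larger of the two
  left end points serves both sets.\<close>

lemma openin_rel_order_topology_left:
  assumes r: "Well_order r" and U: "openin (rel_order_topology r) U" and u: "u \<in> U"
  shows "under r u \<subseteq> U \<or> (\<exists>v \<in> underS r u. aboveS r v \<inter> under r u \<subseteq> U)"
proof -
  note R = Well_orderD[OF r]
  let ?S = "insert (Field r) (underS r ` Field r \<union> aboveS r ` Field r)"
  have "generate_topology_on ?S U"
    using U unfolding rel_order_topology_def openin_topology_generated_by_iff .
  thus ?thesis using u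
  proof (induction U)
    case (Int A B)
    have mono: "aboveS r w \<inter> under r u \<subseteq> aboveS r v \<inter> under r u" if "(v, w) \<in> r" for v w
      using that transD[OF R(2)] antisymD[OF R(3)] by (auto simp: aboveS_def)
    consider "under r u \<subseteq> A" | "under r u \<subseteq> B"
      | v w where "v \<in> underS r u" "aboveS r v \<inter> under r u \<subseteq> A"
        "w \<in> underS r u" "aboveS r w \<inter> under r u \<subseteq> B"
      using Int by auto
    thus ?case
    proof cases
      case 3
      hence "(v, w) \<in> r \<or> (w, v) \<in> r"
        using R(4)[of v w] FieldI1[of v u r] FieldI1[of w u r] by (auto simp: underS_def)
      thus ?thesis using 3 mono by (meson Int_subset_iff order_trans)
    qed (use Int in blast)+
  next
    case (UN K)
    then obtain A where "A \<in> K" "u \<in> A" by blast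
    with UN.IH[OF this] show ?case by blast
  next
    case (Basis s)
    then consider "s = Field r" | a where "s = underS r a" | a where "s = aboveS r a" "a \<in> Field r"
      by auto
    thus ?case
    proof cases
      case 1
      thus ?thesis by (auto simp: under_def Field_def)
    next
      case 2
      hence "under r u \<subseteq> s" using Basis.prems transD[OF R(2)] antisymD[OF R(3)]
        by (auto simp: under_def underS_def)
      thus ?thesis ..
    next
      case 3
      hence "a \<in> underS r u" using Basis.prems by (auto simp: underS_def aboveS_def)
      thus ?thesis using 3 by blast
    qed
  qed simp
qed

text \<open>Follows from the previous lemma applied to the complement of \<open>C\<close>. The
  assumption \<open>ne\<close> covers the least \<open>u\<close>, for which \<open>lim\<close> is
  vacuous.\<close>

lemma closedin_rel_order_topology_left_limit:
  assumes r: "Well_order r" and C: "closedin (rel_order_topology r) C" and u: "u \<in> Field r"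
    and ne: "C \<inter> under r u \<noteq> {}"
    and lim: "\<And>v. v \<in> underS r u \<Longrightarrow> C \<inter> aboveS r v \<inter> under r u \<noteq> {}"
  shows "u \<in> C"
proof (rule ccontr)
  assume "u \<notin> C"
  hence "u \<in> Field r - C" "openin (rel_order_topology r) (Field r - C)"
    using C u by (auto simp: closedin_def topspace_rel_order_topology)
  from openin_rel_order_topology_left[OF r this(2,1)] show False
    using ne lim by blast
qed

section \<open>Comparison of Cantor normal forms\<close>

text \<open>As \<open>u\<close> has no term below \<open>\<omega>^x\<close>, it equals
  \<open>v + \<omega>^x\<close>. An ordinal strictly in between is \<open>v\<close> plus a nonzero
  remainder below \<open>\<omega>^x\<close>, and this remainder supplies the exponent
  \<open>y\<close>.\<close>

lemma omega_pow_gap: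
  assumes r: "Well_order r" and u: "u \<in> Field (omega_pow r)" and x: "u x \<noteq> 0"
    and u0: "\<And>y. y \<in> underS r x \<Longrightarrow> u y = 0"
  defines "v \<equiv> u(x := u x - 1)"
  shows "v \<in> underS (omega_pow r) u"
    and "\<And>w. \<lbrakk>w \<in> aboveS (omega_pow r) v; w \<in> underS (omega_pow r) u\<rbrakk> \<Longrightarrow> \<exists>y \<in> underS r x. w y \<noteq> 0"
proof -
  note R = Well_orderD[OF r]
  have xF: "x \<in> Field r" using u x by (auto simp: Field_omega_pow)
  have "{y. v y \<noteq> 0} \<subseteq> {y. u y \<noteq> 0}" by (auto simp: v_def)
  hence vF: "v \<in> Field (omega_pow r)" using u finite_subset unfolding Field_omega_pow by blast
  have vx: "v x < u x" "\<And>y. y \<noteq> x \<Longrightarrow> v y = u y" using x by (auto simp: v_def)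
  thus "v \<in> underS (omega_pow r) u"
    using u vF xF unfolding underS_def mem_Collect_eq omega_pow_iff
    by (metis (mono_tags, lifting) aboveS_def mem_Collect_eq nat_neq_iff)
  fix w assume "w \<in> aboveS (omega_pow r) v" "w \<in> underS (omega_pow r) u"
  then obtain a b where a: "a \<in> Field r" "v a < w a" "\<And>y. y \<in> aboveS r a \<Longrightarrow> v y = w y"
    and b: "b \<in> Field r" "w b < u b" "\<And>y. y \<in> aboveS r b \<Longrightarrow> w y = u y"
    by (auto simp: aboveS_def underS_def omega_pow_iff)
  have cmp: "p = q \<or> p \<in> underS r q \<and> q \<in> aboveS r p \<or> q \<in> underS r p \<and> p \<in> aboveS r q"
    if "p \<in> Field r" "q \<in> Field r" for p q
    using R(4)[OF that] by (auto simp: aboveS_def underS_def)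
  show "\<exists>y \<in> underS r x. w y \<noteq> 0"
  proof (cases "a \<in> underS r x")
    case True
    thus ?thesis using a(2) by (intro bexI[of _ a]) auto
  next
    \<comment> \<open>The position \<open>a\<close> decides \<open>v < w\<close>, and
      \<open>b\<close> decides \<open>w < u\<close>. If \<open>a\<close> is not below
      \<open>x\<close>, comparing positions forces \<open>a = x\<close> and \<open>b\<close> below
      \<open>x\<close>, where \<open>u\<close> vanishes, contrary to
      \<open>w b < u b\<close>.\<close>
    case False
    have "u a \<le> w a" using a(2) vx(2)[of a] by (cases "a = x") (auto simp: v_def)
    moreover have "b \<notin> aboveS r a"
    proof
      assume "b \<in> aboveS r a"
      hence "v b < u b" "b \<noteq> x" using a(3)[of b] b(2) False cmp[OF a(1) xF] antisymD[OF R(3)]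
        by (auto simp: aboveS_def underS_def)
      thus False using vx by auto
    qed
    ultimately have "b \<in> underS r a" "a \<in> aboveS r b" using cmp[OF a(1) b(1)] b(2) by auto
    hence "w a = u a" using b(3) by blast
    hence "a = x" using a(2) vx(2)[of a] by force
    hence "u b = 0" using \<open>b \<in> underS r a\<close> u0 by blast
    thus ?thesis using b(2) by simp
  qed
qed

lemma omega_pow_fun_upd:
  assumes "f \<in> Field (omega_pow r)" "x \<in> Field r"
  shows "f(x := j) \<in> Field (omega_pow r)"
proof -
  have "{y. (f(x := j)) y \<noteq> 0} \<subseteq> insert x {y. f y \<noteq> 0}" by auto
  moreover from this have "finite {y. (f(x := j)) y \<noteq> 0}"
    by (rule finite_subset) (use assms in \<open>simp add: Field_omega_pow\<close>)
  ultimately show ?thesis using assms unfolding Field_omega_pow by blast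
qed

lemma omega_pow_lessI:
  assumes "f \<in> Field (omega_pow r)" "g \<in> Field (omega_pow r)" "x \<in> Field r" "f x < g x"
    and "\<And>y. y \<in> aboveS r x \<Longrightarrow> f y = g y"
  shows "f \<in> underS (omega_pow r) g"
proof -
  have "f \<noteq> g" using assms(4) by auto
  thus ?thesis using assms unfolding underS_def mem_Collect_eq omega_pow_iff by blast
qed

section \<open>Multiples of powers of \<omega> in the separating sets, and their number\<close>

text \<open>The induction on the exponent, here \<open>b\<close>. A normal form is a multiple of
  \<open>\<omega>^b\<close> iff it vanishes below \<open>b\<close>, and for such \<open>p\<close>
  raising the coefficient at \<open>b\<close> by one adds \<open>\<omega>^b\<close>. The map
  \<open>T\<close> models the separating sets, and \<open>eL\<close> and \<open>eK\<close> the right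
  end points of the source and target intervals.\<close>

lemma rank_preserved_in_image:
  fixes r :: "'a rel" and T :: "('a \<Rightarrow> nat) set \<Rightarrow> ('a \<Rightarrow> nat) set"
  defines "W \<equiv> omega_pow r"
  assumes r: "Well_order r" and eK: "eK \<in> Field W"
    and sub: "\<And>A. T A \<subseteq> under W eK"
    and ne: "\<And>p q. \<lbrakk>p \<in> underS W q; (q, eL) \<in> W\<rbrakk> \<Longrightarrow> T (aboveS W p \<inter> under W q) \<noteq> {}"
    and mono: "\<And>A B. A \<subseteq> B \<Longrightarrow> T A \<subseteq> T B"
    and disj: "\<And>p q B. \<lbrakk>p \<in> underS W q; (q, eL) \<in> W; aboveS W p \<inter> under W q \<inter> B = {}\<rbrakk> \<Longrightarrow>
      T (aboveS W p \<inter> under W q) \<inter> T B = {}"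
    and lim: "\<And>A u. \<lbrakk>(u, eK) \<in> W; T A \<inter> under W u \<noteq> {};
      \<And>v. v \<in> underS W u \<Longrightarrow> T A \<inter> aboveS W v \<inter> under W u \<noteq> {}\<rbrakk> \<Longrightarrow> u \<in> T A"
    and b: "b \<in> Field r" and p: "p \<in> Field W" "\<And>x. x \<in> underS r b \<Longrightarrow> p x = 0"
    and q: "(p(b := Suc (p b)), eL) \<in> W"
  shows "\<exists>k \<in> T (aboveS W p \<inter> under W (p(b := Suc (p b)))). \<forall>x \<in> underS r b. k x = 0"
  using b p q
proof (induction b arbitrary: p rule: wf_induct_rule[OF Well_orderD(5)[OF r]])
  case (1 b)
  note R = Well_orderD[OF r] and Wo = Well_orderD[OF Well_order_omega_pow[OF r], folded W_def]
  define q where "q = p(b := Suc (p b))"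
  define A where "A = aboveS W p \<inter> under W q"
  note upd = omega_pow_fun_upd[where r = r, folded W_def]
  note less = omega_pow_lessI[where r = r, folded W_def]
  have qF: "q \<in> Field W" unfolding q_def by (rule upd[OF 1(3,2)])
  have pq: "p \<in> underS W q"
    by (rule less[OF 1(3) qF 1(2)]) (auto simp: q_def aboveS_def)
  have qL: "(q, eL) \<in> W" using 1(5) unfolding q_def .
  have "\<exists>k \<in> T A. \<forall>x \<in> underS r b. k x = 0"
  proof (cases "underS r b = {}")
    \<comment> \<open>For the least exponent \<open>\<omega>^b\<close> is 1, so every point of
      \<open>T A\<close> will do.\<close>
    case True
    have "T A \<noteq> {}" using ne[OF pq qL] unfolding A_def .
    thus ?thesis using True by auto
  next
    case False
    \<comment> \<open>The multiples of \<open>\<omega>^c\<close> in \<open>T A\<close>.\<close>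
    define S where "S = (\<lambda>c. {k \<in> T A. \<forall>x \<in> underS r c. k x = 0})"
    have S_anti: "S c \<subseteq> S d" if "(d, c) \<in> r" for c d
      using that transD[OF R(2)] antisymD[OF R(3)] unfolding S_def underS_def by blast
    have inf: "infinite (S c)" if c: "c \<in> underS r b" for c
    proof -
      have cF: "c \<in> Field r" and cb: "(c, b) \<in> r - Id" using c by (auto simp: underS_def Field_def)
      \<comment> \<open>Since \<open>p c = 0\<close>, this is \<open>p + \<omega>^c * j\<close>,
        which stays below \<open>q = p + \<omega>^b\<close>. The intervals \<open>I j\<close>
        between consecutive terms are disjoint, and by induction each contributes its own member of
        \<open>S c\<close>.\<close>
      define P where "P = (\<lambda>j::nat. p(c := j))"
      have PF: "P j \<in> Field W" for j unfolding P_def by (rule upd[OF 1(3) cF])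
      have P_less: "P i \<in> underS W (P j)" if "i < j" for i j
        by (rule less[OF PF PF cF]) (use that in \<open>auto simp: P_def aboveS_def\<close>)
      have P0: "P 0 = p" using 1(4)[OF c] by (auto simp: P_def)
      have Pq: "P j \<in> underS W q" for j
        by (rule less[OF PF qF 1(2)])
          (use cb antisymD[OF R(3)] in \<open>auto simp: P_def q_def aboveS_def\<close>)
      define I where "I = (\<lambda>j. aboveS W (P j) \<inter> under W (P (Suc j)))"
      have "I j \<subseteq> A" for j
      proof -
        have "(p, P j) \<in> W" using P_less[of 0 j] P0 Wo(1)[OF 1(3)] by (cases j) (auto simp: underS_def)
        thus ?thesis using Pq[of "Suc j"] transD[OF Wo(2)] antisymD[OF Wo(3)]
          unfolding I_def A_def aboveS_def under_def underS_def by blast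
      qed
      hence IT: "T (I j) \<subseteq> T A" for j by (rule mono)
      have "\<exists>k \<in> T (I j). \<forall>x \<in> underS r c. k x = 0" for j
      proof -
        have "(P j) (c := Suc ((P j) c)) = P (Suc j)" by (simp add: P_def)
        moreover have "(P j) x = 0" if "x \<in> underS r c" for x
          using that 1(4) cb transD[OF R(2)] antisymD[OF R(3)] by (fastforce simp: P_def underS_def)
        moreover have "(P (Suc j), eL) \<in> W"
          using Pq[of "Suc j"] qL transD[OF Wo(2)] by (auto simp: underS_def)
        ultimately show ?thesis using 1(1)[OF cb cF PF[of j]] unfolding I_def by simp
      qed
      then obtain k where k: "\<And>j. k j \<in> T (I j)" "\<And>j x. x \<in> underS r c \<Longrightarrow> k j x = 0" by metis
      have neq: "k i \<noteq> k j" if "i < j" for i j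
      proof -
        have "(P (Suc i), P j) \<in> W"
          using P_less[of "Suc i" j] that Wo(1)[OF PF] by (cases "Suc i = j") (auto simp: underS_def)
        hence "I i \<inter> I j = {}" using transD[OF Wo(2)] antisymD[OF Wo(3)]
          unfolding I_def aboveS_def under_def by blast
        moreover have "(P (Suc i), eL) \<in> W"
          using Pq[of "Suc i"] qL transD[OF Wo(2)] by (auto simp: underS_def)
        ultimately have "T (I i) \<inter> T (I j) = {}"
          using disj[OF P_less[of i "Suc i"]] unfolding I_def by blast
        thus ?thesis using k(1)[of i] k(1)[of j] by auto
      qed
      hence "inj k" by (metis injI linorder_neqE_nat)
      moreover have "range k \<subseteq> S c" using k IT by (fastforce simp: S_def)
      ultimately show ?thesis using range_inj_infinite infinite_super by blast
    qed
    \<comment> \<open>The least member of \<open>Q\<close> is a limit of the sets \<open>S c\<close> and hence a multiple of \<open>\<omega>\<^sup>b\<close>.\<close>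
    define Q where "Q = {u. (u, eK) \<in> W \<and> (\<forall>c \<in> underS r b. infinite (S c \<inter> under W u))}"
    have "S c \<inter> under W eK = S c" for c using sub by (auto simp: S_def)
    hence "eK \<in> Q" using inf Wo(1)[OF eK] by (auto simp: Q_def)
    then obtain u where u: "u \<in> Q" and min: "\<And>v. (v, u) \<in> W - Id \<Longrightarrow> v \<notin> Q"
      using Wo(5) unfolding wf_eq_minimal by blast
    have uK: "(u, eK) \<in> W" and uF: "u \<in> Field W" using u by (auto simp: Q_def intro: FieldI1)
    have jump: "\<exists>c \<in> underS r b. finite (S c \<inter> under W v)" if "v \<in> underS W u" for v
      using min[of v] that uK transD[OF Wo(2)] unfolding Q_def underS_def by blast
    \<comment> \<open>Infinitely many members of \<open>S c\<close> lie up to \<open>u\<close> but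
      only finitely many up to \<open>v\<close>; as \<open>u\<close> is a single point, some lie
      strictly between.\<close>
    have meets: "S c \<inter> aboveS W v \<inter> underS W u \<noteq> {}"
      if c: "c \<in> underS r b" and fin: "finite (S c \<inter> under W v)" and v: "v \<in> underS W u" for c v
    proof
      assume empty: "S c \<inter> aboveS W v \<inter> underS W u = {}"
      have "S c \<inter> under W u \<subseteq> insert u (S c \<inter> under W v)"
      proof
        fix w assume w: "w \<in> S c \<inter> under W u"
        hence "(w, v) \<in> W \<or> (v, w) \<in> W" using Wo(4)[of w v] v
          by (auto simp: under_def underS_def intro: FieldI1)
        thus "w \<in> insert u (S c \<inter> under W v)"
          using empty w Wo(1)[of v] v by (auto simp: under_def underS_def aboveS_def intro: FieldI1)
      qed
      thus False using fin u c finite_subset by (auto simp: Q_def)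
    qed
    have "u \<in> T A"
    proof (rule lim[OF uK])
      from False obtain c where "c \<in> underS r b" by blast
      hence "S c \<inter> under W u \<noteq> {}" using u unfolding Q_def by force
      thus "T A \<inter> under W u \<noteq> {}" by (auto simp: S_def)
      show "T A \<inter> aboveS W v \<inter> under W u \<noteq> {}" if "v \<in> underS W u" for v
        using jump[OF that] meets[OF _ _ that] unfolding S_def under_def underS_def by blast
    qed
    moreover have "u x = 0" if x: "x \<in> underS r b" for x
    proof (rule ccontr)
      assume "u x \<noteq> 0"
      \<comment> \<open>The lowest exponent in the normal form of \<open>u\<close>, so that
        \<open>u = v + \<omega>^y\<close> for the \<open>v\<close> below.\<close>
      then obtain y where y: "u y \<noteq> 0" "(y, x) \<in> r" "\<And>z. (z, y) \<in> r - Id \<Longrightarrow> \<not> (u z \<noteq> 0 \<and> (z, x) \<in> r)"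
        using R(5)[unfolded wf_eq_minimal, rule_format, of x "{z. u z \<noteq> 0 \<and> (z, x) \<in> r}"]
          R(1)[of x] x by (auto simp: underS_def intro: FieldI1)
      have u0: "u z = 0" if "z \<in> underS r y" for z
        using y that transD[OF R(2)] by (auto simp: underS_def)
      define v where "v = u(y := u y - 1)"
      note gap = omega_pow_gap[where r = r and u = u and x = y, folded W_def v_def, OF r uF y(1) u0]
      obtain c where c: "c \<in> underS r b" "finite (S c \<inter> under W v)"
        using jump[OF gap(1)] by blast
      have yb: "y \<in> underS r b"
        using y(2) x transD[OF R(2)] antisymD[OF R(3)] by (auto simp: underS_def)
      have "(c, y) \<in> r \<or> (y, c) \<in> r" using R(4)[of c y] c(1) yb by (auto simp: underS_def intro: FieldI1)
      \<comment> \<open>The larger of \<open>c\<close> and \<open>y\<close>. Being at least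
        \<open>c\<close> keeps the set up to \<open>v\<close> finite, so \<open>S d\<close> has a
        member strictly between \<open>v\<close> and \<open>u\<close>; being at least
        \<open>y\<close> makes that member vanish below \<open>y\<close>, against
        \<open>gap\<close>.\<close>
      then obtain d where d: "d \<in> underS r b" "finite (S d \<inter> under W v)" "(y, d) \<in> r"
      proof
        assume "(c, y) \<in> r"
        hence "finite (S y \<inter> under W v)" using c(2) S_anti by (meson Int_mono finite_subset order_refl)
        thus thesis using that yb R(1)[of y] y(2) by (auto intro: FieldI1)
      next
        assume "(y, c) \<in> r"
        thus thesis using that c by blast
      qed
      obtain w where w: "w \<in> S d" "w \<in> aboveS W v" "w \<in> underS W u"
        using meets[OF d(1,2) gap(1)] by blast
      hence "w z = 0" if "z \<in> underS r y" for z
        using S_anti[OF d(3)] that by (auto simp: S_def)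
      thus False using gap(2)[OF _ w(2,3)] by auto
    qed
    ultimately show ?thesis by blast
  qed
  thus ?case unfolding A_def q_def .
qed

text \<open>As \<open>t\<close> is the largest exponent, \<open>e k\<close> is
  \<open>\<omega>^t * k\<close>, and a normal form vanishing below \<open>t\<close> is some
  \<open>e k\<close>. The \<open>n\<close> disjoint intervals between consecutive \<open>e i\<close>
  yield distinct ones up to \<open>e m\<close>, of which there are \<open>m + 1\<close> because
  \<open>e 0\<close> counts.\<close>

lemma top_rank_count:
  fixes r :: "'a rel" and T :: "('a \<Rightarrow> nat) set \<Rightarrow> ('a \<Rightarrow> nat) set" and t :: 'a
  defines "W \<equiv> omega_pow r" and "e \<equiv> \<lambda>k x. if x = t then k else 0"
  assumes r: "Well_order r" and t: "t \<in> Field r" "\<And>x. x \<in> Field r \<Longrightarrow> (x, t) \<in> r"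
    and sub: "\<And>A. T A \<subseteq> under W (e m)"
    and ne: "\<And>p q. \<lbrakk>p \<in> underS W q; (q, e n) \<in> W\<rbrakk> \<Longrightarrow> T (aboveS W p \<inter> under W q) \<noteq> {}"
    and mono: "\<And>A B. A \<subseteq> B \<Longrightarrow> T A \<subseteq> T B"
    and disj: "\<And>p q B. \<lbrakk>p \<in> underS W q; (q, e n) \<in> W; aboveS W p \<inter> under W q \<inter> B = {}\<rbrakk> \<Longrightarrow>
      T (aboveS W p \<inter> under W q) \<inter> T B = {}"
    and lim: "\<And>A u. \<lbrakk>(u, e m) \<in> W; T A \<inter> under W u \<noteq> {};
      \<And>v. v \<in> underS W u \<Longrightarrow> T A \<inter> aboveS W v \<inter> under W u \<noteq> {}\<rbrakk> \<Longrightarrow> u \<in> T A"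
  shows "n \<le> m + 1"
proof -
  note R = Well_orderD[OF r] and Wo = Well_orderD[OF Well_order_omega_pow[OF r], folded W_def]
  have "(\<lambda>_. 0) \<in> Field W" by (simp add: W_def Field_omega_pow)
  moreover have "e k = (\<lambda>_. 0)(t := k)" for k by (auto simp: e_def)
  ultimately have eF: "e k \<in> Field W" for k
    using omega_pow_fun_upd[where r = r, folded W_def] t(1) by metis
  have above_t: "aboveS r t = {}"
    using t antisymD[OF R(3)] by (auto simp: aboveS_def intro: FieldI2)
  have e_less: "e i \<in> underS W (e j)" if "i < j" for i j
  proof -
    have "e i t < e j t" using that by (simp add: e_def)
    thus ?thesis
      using omega_pow_lessI[where r = r, folded W_def] eF above_t t(1) by (metis empty_iff)
  qed
  have e_le: "(e i, e j) \<in> W" if "i \<le> j" for i j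
    using e_less[of i j] that Wo(1)[OF eF] by (cases "i = j") (auto simp: underS_def)
  define I where "I = (\<lambda>i. aboveS W (e i) \<inter> under W (e (Suc i)))"
  have "\<exists>k \<in> T (I i). \<forall>x \<in> underS r t. k x = 0" if "i < n" for i
  proof -
    have upd: "(e i) (t := Suc (e i t)) = e (Suc i)" by (auto simp: e_def)
    have e0: "e i x = 0" if "x \<in> underS r t" for x using that by (auto simp: e_def underS_def)
    have eL: "((e i)(t := Suc (e i t)), e n) \<in> W" using e_le[of "Suc i" n] that upd by simp
    show ?thesis
      using rank_preserved_in_image[where T = T and eL = "e n" and eK = "e m" and p = "e i",
          OF r, folded W_def, OF eF sub ne mono disj lim t(1) eF e0 eL]
      unfolding upd I_def .
  qed
  then obtain k where k: "\<And>i. i < n \<Longrightarrow> k i \<in> T (I i)" "\<And>i x. \<lbrakk>i < n; x \<in> underS r t\<rbrakk> \<Longrightarrow> k i x = 0"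
    by metis
  have neq: "k i \<noteq> k j" if "i < j" "j < n" for i j
  proof -
    have "(e (Suc i), e j) \<in> W" using e_le that by simp
    hence "I i \<inter> I j = {}" using transD[OF Wo(2)] antisymD[OF Wo(3)]
      unfolding I_def aboveS_def under_def by blast
    hence "T (I i) \<inter> T (I j) = {}"
      using disj[OF e_less[of i "Suc i"] e_le] that unfolding I_def by auto
    thus ?thesis using k(1)[of i] k(1)[of j] that by auto
  qed
  have inj: "inj_on k {..<n}" by (rule inj_onI) (metis lessThan_iff linorder_neqE_nat neq)
  have "k i \<in> e ` {..m}" if i: "i < n" for i
  proof -
    have kW: "(k i, e m) \<in> W" using k(1)[OF i] sub by (auto simp: under_def)
    hence kF: "k i \<in> Field W" by (rule FieldI1)
    have "k i x = 0" if "x \<noteq> t" for x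
    proof (cases "x \<in> Field r")
      case True
      thus ?thesis using k(2)[OF i] t(2) that by (auto simp: underS_def)
    next
      case False
      thus ?thesis using kF by (auto simp: W_def Field_omega_pow)
    qed
    hence ki: "k i = e (k i t)" by (auto simp: e_def)
    have "k i t \<le> m"
    proof (rule ccontr)
      assume "\<not> k i t \<le> m"
      hence "e m \<in> underS W (k i)" using e_less[of m "k i t"] ki by simp
      thus False using kW antisymD[OF Wo(3)] by (auto simp: underS_def)
    qed
    thus ?thesis using ki by blast
  qed
  hence "k ` {..<n} \<subseteq> e ` {..m}" by auto
  hence "card {..<n} \<le> card (e ` {..m})"
    using card_inj_on_le[OF inj] by auto
  also have "\<dots> \<le> card {..m}" by (rule card_image_le) simp
  finally show ?thesis by simp
qed

section \<open>Intervals as initial segments of a common power of \<omega>\<close>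

text \<open>
  In a normal form with exponents in \<open>\<alpha> + 1\<close> the exponent \<^const>\<open>None\<close> is \<open>\<alpha>\<close> itself.  The pair \<open>(g, i)\<close> is
  the ordinal \<open>\<omega>\<^sup>\<alpha> \<cdot> i + g\<close>, and \<^const>\<open>None\<close> on the argument side is the right end point \<open>\<omega>\<^sup>\<alpha> \<cdot> n\<close>.
\<close>

definition cnf_embedding :: "nat \<Rightarrow> (('a \<Rightarrow> nat) \<times> nat) option \<Rightarrow> 'a option \<Rightarrow> nat" where
  "cnf_embedding n u = (case u of None \<Rightarrow> (\<lambda>x. if x = None then n else 0)
    | Some (g, i) \<Rightarrow> (\<lambda>x. case x of None \<Rightarrow> i | Some y \<Rightarrow> g y))"

lemma Field_omega_pow_succ_iff:
  "f \<in> Field (omega_pow (ord_succ r)) \<longleftrightarrow> f \<circ> Some \<in> Field (omega_pow r)"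
proof -
  have eq: "Some ` {x. (f \<circ> Some) x \<noteq> 0} = {u. f u \<noteq> 0} - {None}"
  proof (rule set_eqI)
    show "u \<in> Some ` {x. (f \<circ> Some) x \<noteq> 0} \<longleftrightarrow> u \<in> {u. f u \<noteq> 0} - {None}" for u
      by (cases u) auto
  qed
  have "finite {x. (f \<circ> Some) x \<noteq> 0} \<longleftrightarrow> finite {u. f u \<noteq> 0}"
    using finite_image_iff[of Some "{x. (f \<circ> Some) x \<noteq> 0}"] unfolding eq by simp
  moreover have "{x. (f \<circ> Some) x \<noteq> 0} \<subseteq> Field r \<longleftrightarrow> {u. f u \<noteq> 0} \<subseteq> insert None (Some ` Field r)"
  proof -
    have "Some ` {x. (f \<circ> Some) x \<noteq> 0} \<subseteq> Some ` Field r \<longleftrightarrow>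
        {u. f u \<noteq> 0} \<subseteq> insert None (Some ` Field r)"
      unfolding eq by blast
    thus ?thesis by (simp add: inj_image_subset_iff)
  qed
  ultimately show ?thesis unfolding Field_omega_pow Field_ord_succ mem_Collect_eq by simp
qed

text \<open>The largest exponent \<open>None\<close> is compared first; this makes explicit the
  order behind the isomorphism of \<open>omega_pow_succ\<close>.\<close>

lemma omega_pow_succ_iff:
  assumes f: "f \<in> Field (omega_pow (ord_succ r))" and g: "g \<in> Field (omega_pow (ord_succ r))"
  shows "(f, g) \<in> omega_pow (ord_succ r) \<longleftrightarrow>
    f None < g None \<or> f None = g None \<and> (f \<circ> Some, g \<circ> Some) \<in> omega_pow r"
proof -
  have above: "aboveS (ord_succ r) (Some x) = insert None (Some ` aboveS r x)" if "x \<in> Field r" for x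
    using that by (auto simp: aboveS_def ord_succ_def)
  have above_None: "aboveS (ord_succ r) None = {}"
    by (auto simp: aboveS_def ord_succ_def)
  have eq: "f = g \<longleftrightarrow> f None = g None \<and> f \<circ> Some = g \<circ> Some"
    unfolding fun_eq_iff using option.exhaust by (metis comp_apply)
  have "(f, g) \<in> omega_pow (ord_succ r) \<longleftrightarrow> f = g \<or> f None < g None \<or>
      f None = g None \<and>
      (\<exists>x \<in> Field r. f (Some x) < g (Some x) \<and> (\<forall>y \<in> aboveS r x. f (Some y) = g (Some y)))"
    unfolding omega_pow_iff[of _ _ "ord_succ r"] using f g
    by (simp add: Field_ord_succ above above_None cong: bex_cong) blast
  moreover have "f \<circ> Some \<in> Field (omega_pow r)" "g \<circ> Some \<in> Field (omega_pow r)"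
    using f g by (simp_all only: Field_omega_pow_succ_iff)
  ultimately show ?thesis
    unfolding omega_pow_iff[of _ _ r] eq by (auto simp: comp_def)
qed

text \<open>Places the intervals for all \<open>n\<close> into the one well-order
  \<open>\<omega>^(\<alpha>+1)\<close>, where source and target share the same notion of a multiple
  of a power of \<omega>.\<close>

lemma cnf_embedding:
  fixes r :: "'a rel" and n :: nat
  assumes r: "Well_order r"
  defines "s \<equiv> ord_succ (ord_mult (omega_pow r) (natLeq_on n))"
    and "W \<equiv> omega_pow (ord_succ r)"
  shows "bij_betw (cnf_embedding n) (Field s) (under W (cnf_embedding n None))"
    and "\<And>u v. \<lbrakk>u \<in> Field s; v \<in> Field s\<rbrakk> \<Longrightarrow>
      (cnf_embedding n u, cnf_embedding n v) \<in> W \<longleftrightarrow> (u, v) \<in> s"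
    and "cnf_embedding k None \<in> Field W"
proof -
  note V = Well_order_omega_pow[OF r] and N = natLeq_on_Well_order[of n]
  have Fs': "Field s = insert None (Some ` Field (ord_mult (omega_pow r) (natLeq_on n)))"
    unfolding s_def by (rule Field_ord_succ)
  have Fs: "Field s = insert None (Some ` (Field (omega_pow r) \<times> {..<n}))"
    unfolding s_def Field_ord_succ Field_ord_mult[OF V N] Field_natLeq_on by auto
  have h_None: "cnf_embedding k None None = k" "cnf_embedding k None \<circ> Some = (\<lambda>_. 0)" for k
    by (auto simp: cnf_embedding_def)
  have h_Some: "cnf_embedding k (Some (g, i)) None = i" "cnf_embedding k (Some (g, i)) \<circ> Some = g"
    for k g i by (auto simp: cnf_embedding_def)
  have zero: "(\<lambda>_. 0) \<in> Field (omega_pow r)" by (simp add: Field_omega_pow)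
  show F_None: "cnf_embedding k None \<in> Field W" for k
    unfolding W_def Field_omega_pow_succ_iff h_None by (rule zero)
  have hF: "cnf_embedding n u \<in> Field W" if u: "u \<in> Field s" for u
    using u F_None unfolding Fs W_def Field_omega_pow_succ_iff by (auto simp: h_Some)
  have s_None: "(u, None) \<in> s" if "u \<in> Field s" for u
    using that unfolding Fs' by (simp add: s_def ord_succ_def)
  have s_Some: "(Some p, v) \<in> s \<longleftrightarrow> (case v of None \<Rightarrow> Some p \<in> Field s
      | Some q \<Rightarrow> (p, q) \<in> ord_mult (omega_pow r) (natLeq_on n))" "(None, Some p) \<notin> s" for p v
    unfolding Fs' by ((cases p; auto simp: s_def ord_succ_def split: option.split)+)
  show iff: "(cnf_embedding n u, cnf_embedding n v) \<in> W \<longleftrightarrow> (u, v) \<in> s"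
    if u: "u \<in> Field s" and v: "v \<in> Field s" for u v
    unfolding W_def omega_pow_succ_iff[OF hF[OF u, unfolded W_def] hF[OF v, unfolded W_def]]
    using u v zero Well_orderD(1)[OF V]
    by (auto simp: Fs h_None h_Some s_Some s_None ord_mult_def Field_natLeq_on)
  have S: "Well_order s" unfolding s_def by (intro Well_order_ord_succ Well_order_ord_mult V N)
  show "bij_betw (cnf_embedding n) (Field s) (under W (cnf_embedding n None))"
    unfolding bij_betw_def
  proof (intro conjI)
    show "inj_on (cnf_embedding n) (Field s)"
      by (rule inj_onI)
        (metis iff antisymD[OF Well_orderD(3)[OF S]] Well_orderD(1)[OF S])
    have "cnf_embedding n u \<in> under W (cnf_embedding n None)" if "u \<in> Field s" for u
      using iff[OF that, of None] s_None[OF that] by (auto simp: under_def Fs)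
    moreover have "G \<in> cnf_embedding n ` Field s" if "G \<in> under W (cnf_embedding n None)" for G
    proof -
      have GF: "G \<in> Field W" and "(G, cnf_embedding n None) \<in> W"
        using that by (auto simp: under_def intro: FieldI1)
      hence G: "G None < n \<or> G None = n \<and> (G \<circ> Some, \<lambda>_. 0) \<in> omega_pow r"
        unfolding W_def using omega_pow_succ_iff[of G r "cnf_embedding n None"] F_None
        by (simp add: h_None W_def)
      have "G = cnf_embedding n (Some (G \<circ> Some, G None))"
        by (auto simp: cnf_embedding_def fun_eq_iff split: option.split)
      moreover have "G \<circ> Some \<in> Field (omega_pow r)"
        using GF by (simp add: W_def Field_omega_pow_succ_iff)
      \<comment> \<open>With coefficient \<open>n\<close> at the top exponent only the end point
        remains, since nothing is smaller than the zero function.\<close>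
      moreover have "G = cnf_embedding n None" if "G None = n" "(G \<circ> Some, \<lambda>_. 0) \<in> omega_pow r"
      proof -
        have "G \<circ> Some = (\<lambda>_. 0)" using that(2) by (auto simp: omega_pow_iff)
        hence "G x = cnf_embedding n None x" for x
          using that(1) by (cases x) (auto simp: cnf_embedding_def fun_eq_iff)
        thus ?thesis by blast
      qed
      ultimately show ?thesis using G unfolding Fs by blast
    qed
    ultimately show "cnf_embedding n ` Field s = under W (cnf_embedding n None)" by blast
  qed
qed

section \<open>Transfer to spaces of continuous functions and conclusion\<close>

lemma no_low_distortion_embedding:
  fixes \<alpha> :: "'a rel"
  defines "s \<equiv> \<lambda>n. ord_mult (omega_pow \<alpha>) (natLeq_on n)"
  assumes \<alpha>: "Well_order \<alpha>" and f: "f \<in> mspace (C_interval (s n)) \<rightarrow> mspace (C_interval (s m))"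
    and lip: "lipschitz_bounds (C_interval (s n)) (C_interval (s m)) f C1 C2" and C: "C2 < 2 * C1"
  shows "n \<le> m + 1"
proof -
  define r where "r = (\<lambda>n. ord_succ (s n))"
  define W where "W = omega_pow (ord_succ \<alpha>)"
  define h :: "nat \<Rightarrow> (('a \<Rightarrow> nat) \<times> nat) option \<Rightarrow> 'a option \<Rightarrow> nat" where "h = cnf_embedding"
  define e where "e = (\<lambda>k x. if x = (None :: 'a option) then k else (0::nat))"
  have e_eq: "(\<lambda>x. if x = (None :: 'a option) then k else (0::nat)) = e k" for k by (simp add: e_def)
  have bij: "bij_betw (h k) (Field (r k)) (under W (e k))" for k
    using cnf_embedding(1)[OF \<alpha>, of k] unfolding r_def s_def W_def h_def e_def cnf_embedding_def by simp
  have iff: "(h k u, h k v) \<in> W \<longleftrightarrow> (u, v) \<in> r k" if "u \<in> Field (r k)" "v \<in> Field (r k)" for k u v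
    using cnf_embedding(2)[OF \<alpha>, of u k v] that unfolding r_def s_def W_def h_def by blast
  have inj: "h k u = h k v \<longleftrightarrow> u = v" if "u \<in> Field (r k)" "v \<in> Field (r k)" for k u v
    using bij[of k] that by (auto simp: bij_betw_def inj_on_def)
  have lift: "\<exists>u \<in> Field (r k). h k u = G" if "(G, e k) \<in> W" for G k
  proof -
    have "G \<in> h k ` Field (r k)"
      using bij_betw_imp_surj_on[OF bij[of k]] that by (simp add: under_def)
    thus ?thesis by blast
  qed
  have WoW: "Well_order W"
    unfolding W_def by (intro Well_order_omega_pow Well_order_ord_succ \<alpha>)
  note Wo = Well_orderD[OF WoW]
  have Wor: "Well_order (r k)" for k
    unfolding r_def s_def
    by (intro Well_order_ord_succ Well_order_ord_mult Well_order_omega_pow \<alpha> natLeq_on_Well_order)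
  have None: "None \<in> Field (r k)" for k by (simp add: r_def Field_ord_succ)
  have f': "f \<in> mspace (cfunspace (rel_order_topology (r n)) euclidean_metric) \<rightarrow>
      mspace (cfunspace (rel_order_topology (r m)) euclidean_metric)"
    and lip': "lipschitz_bounds (cfunspace (rel_order_topology (r n)) euclidean_metric)
      (cfunspace (rel_order_topology (r m)) euclidean_metric) f C1 C2"
    using f lip unfolding C_interval_def r_def by auto
  have topne: "topspace (rel_order_topology (r k)) \<noteq> {}" for k
    using None by (auto simp: topspace_rel_order_topology)
  obtain T0 where T0: "\<And>A. closedin (rel_order_topology (r m)) (T0 A)"
    "\<And>A. \<lbrakk>openin (rel_order_topology (r n)) A; closedin (rel_order_topology (r n)) A; A \<noteq> {}\<rbrakk>
      \<Longrightarrow> T0 A \<noteq> {}"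
    "\<And>A B. A \<subseteq> B \<Longrightarrow> T0 A \<subseteq> T0 B"
    "\<And>A B. \<lbrakk>openin (rel_order_topology (r n)) A; closedin (rel_order_topology (r n)) A; A \<inter> B = {}\<rbrakk>
      \<Longrightarrow> T0 A \<inter> T0 B = {}"
    using separating_closed_sets[OF f' lip' C topne topne] by metis
  have T0_sub: "T0 A \<subseteq> Field (r m)" for A
    using closedin_subset[OF T0(1)] by (simp add: topspace_rel_order_topology)
  \<comment> \<open>The sets \<open>T0\<close> are transported to normal forms: pull back along
    \<open>h n\<close>, apply \<open>T0\<close>, push forward along \<open>h m\<close>.\<close>
  define pre where "pre = (\<lambda>A. {u \<in> Field (r n). h n u \<in> A})"
  define T where "T = (\<lambda>A. h m ` T0 (pre A))"
  have clopen: "openin (rel_order_topology (r n)) (pre (aboveS W p \<inter> under W q))"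
    "closedin (rel_order_topology (r n)) (pre (aboveS W p \<inter> under W q))"
    "pre (aboveS W p \<inter> under W q) \<noteq> {}"
    if pq: "p \<in> underS W q" "(q, e n) \<in> W" for p q
  proof -
    obtain b where b: "b \<in> Field (r n)" "h n b = q" using lift pq by blast
    have "(p, e n) \<in> W" using pq transD[OF Wo(2)] by (auto simp: underS_def)
    then obtain a where a: "a \<in> Field (r n)" "h n a = p" using lift by blast
    \<comment> \<open>A half-open interval pulls back to a difference of two initial segments, both
      clopen by \<open>clopen_under\<close>.\<close>
    have "u \<in> pre (aboveS W p \<inter> under W q) \<longleftrightarrow> u \<in> under (r n) b - under (r n) a" for u
    proof (cases "u \<in> Field (r n)")
      case True
      have "h n u \<in> aboveS W p \<longleftrightarrow> (u, a) \<notin> r n"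
        using True a iff[OF True a(1)] iff[OF a(1) True] inj[OF True a(1)]
          Well_orderD(1,4)[OF Wor, of _ n] antisymD[OF Well_orderD(3)[OF Wor, of n]]
        by (auto simp: aboveS_def)
      thus ?thesis using True b iff[OF True b(1)] by (auto simp: pre_def under_def)
    qed (auto simp: pre_def under_def intro: FieldI1)
    hence eq: "pre (aboveS W p \<inter> under W q) = under (r n) b - under (r n) a" by blast
    show "openin (rel_order_topology (r n)) (pre (aboveS W p \<inter> under W q))"
      "closedin (rel_order_topology (r n)) (pre (aboveS W p \<inter> under W q))"
      unfolding eq using clopen_under[OF Wor] a b by blast+
    show "pre (aboveS W p \<inter> under W q) \<noteq> {}"
      using b pq Wo(1)[of q] by (auto simp: pre_def aboveS_def under_def underS_def intro: FieldI1)
  qed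
  show ?thesis
  proof (rule top_rank_count[where r = "ord_succ \<alpha>" and t = None and T = T and n = n and m = m,
        folded W_def, unfolded e_eq])
    show "Well_order (ord_succ \<alpha>)" by (rule Well_order_ord_succ[OF \<alpha>])
    show "None \<in> Field (ord_succ \<alpha>)" by (simp add: Field_ord_succ)
    show "(x, None) \<in> ord_succ \<alpha>" if "x \<in> Field (ord_succ \<alpha>)" for x
      using that unfolding Field_ord_succ by (auto simp: ord_succ_def)
    show "T A \<subseteq> under W (e m)" for A
      using T0_sub bij[of m] by (auto simp: T_def bij_betw_def)
    show "T (aboveS W p \<inter> under W q) \<noteq> {}" if "p \<in> underS W q" "(q, e n) \<in> W" for p q
      using T0(2)[OF clopen[OF that]] by (simp add: T_def)
    show "T A \<subseteq> T B" if "A \<subseteq> B" for A B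
    proof -
      have "pre A \<subseteq> pre B" using that by (auto simp: pre_def)
      thus ?thesis unfolding T_def by (intro image_mono T0(3))
    qed
    show "T (aboveS W p \<inter> under W q) \<inter> T B = {}"
      if "p \<in> underS W q" "(q, e n) \<in> W" "aboveS W p \<inter> under W q \<inter> B = {}" for p q B
    proof -
      have "pre (aboveS W p \<inter> under W q) \<inter> pre B = {}" using that by (auto simp: pre_def)
      hence "T0 (pre (aboveS W p \<inter> under W q)) \<inter> T0 (pre B) = {}"
        using T0(4) clopen[OF that(1,2)] by blast
      thus ?thesis using inj T0_sub unfolding T_def by blast
    qed
    show "u \<in> T A" if u: "(u, e m) \<in> W" and ne: "T A \<inter> under W u \<noteq> {}"
      and lim: "\<And>v. v \<in> underS W u \<Longrightarrow> T A \<inter> aboveS W v \<inter> under W u \<noteq> {}" for A u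
    proof -
      obtain w where w: "w \<in> Field (r m)" "h m w = u" using lift u by blast
      have "w \<in> T0 (pre A)"
      proof (rule closedin_rel_order_topology_left_limit[OF Wor T0(1) w(1)])
        show "T0 (pre A) \<inter> under (r m) w \<noteq> {}"
          using ne iff[OF _ w(1)] T0_sub w(2) by (auto simp: T_def under_def)
        fix v assume "v \<in> underS (r m) w"
        hence v: "v \<in> Field (r m)" "(v, w) \<in> r m" "v \<noteq> w" by (auto simp: underS_def intro: FieldI1)
        hence "h m v \<in> underS W u" using iff[OF v(1) w(1)] inj[OF v(1) w(1)] w(2)
          by (auto simp: underS_def)
        from lim[OF this] obtain t where t: "t \<in> T0 (pre A)" "h m t \<in> aboveS W (h m v)"
          "(h m t, u) \<in> W" by (auto simp: T_def under_def)
        hence "t \<in> aboveS (r m) v" "t \<in> under (r m) w"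
          using iff[OF v(1), of t] iff[OF _ w(1), of t] T0_sub w(2) by (auto simp: aboveS_def under_def)
        thus "T0 (pre A) \<inter> aboveS (r m) v \<inter> under (r m) w \<noteq> {}" using t(1) by blast
      qed
      thus ?thesis using w(2) by (auto simp: T_def)
    qed
  qed
qed

theorem proposition13:
  fixes D :: real
  assumes "1 \<le> D" and "D < 2"
  shows "\<forall>m::nat. 1 \<le> m \<longrightarrow>
           (\<exists>n::nat. 1 \<le> n \<and>
             (\<forall>\<alpha> :: nat rel. \<alpha> <o cardSuc natLeq \<longrightarrow>
               \<not> embeds_with_distortion
                   (C_interval (ord_mult (omega_pow \<alpha>) (natLeq_on n)))
                   (C_interval (ord_mult (omega_pow \<alpha>) (natLeq_on m))) D))"
proof (intro allI impI)
  fix m :: nat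
  have "\<not> embeds_with_distortion (C_interval (ord_mult (omega_pow \<alpha>) (natLeq_on (m + 2))))
      (C_interval (ord_mult (omega_pow \<alpha>) (natLeq_on m))) D" (is "\<not> embeds_with_distortion ?L ?K D")
    if "\<alpha> <o cardSuc natLeq" for \<alpha> :: "nat rel"
  proof
    have \<alpha>: "Well_order \<alpha>" using that by (simp add: ordLess_def)
    assume "embeds_with_distortion ?L ?K D"
    then obtain f where f: "lipschitz_embedding ?L ?K f" "distortion ?L ?K f \<le> D"
      unfolding embeds_with_distortion_def by blast
    let ?R = "{C2 / C1 | C1 C2. lipschitz_bounds ?L ?K f C1 C2}"
    \<comment> \<open>Nonemptiness gives \<open>Inf\<close> its meaning; an infimum below 2 then
      yields one pair of constants with ratio below 2.\<close>
    have "?R \<noteq> {}" using f(1) unfolding lipschitz_embedding_def by blast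
    moreover have "Inf ?R < 2" using f(2) assms(2) unfolding distortion_def by linarith
    ultimately have "\<exists>c \<in> ?R. c < 2" by (rule cInf_lessD)
    then obtain C1 C2 where C: "lipschitz_bounds ?L ?K f C1 C2" "C2 / C1 < 2" by blast
    hence "C2 < 2 * C1" unfolding lipschitz_bounds_def by (simp add: divide_less_eq)
    moreover have "f \<in> mspace ?L \<rightarrow> mspace ?K" using f(1) unfolding lipschitz_embedding_def by blast
    ultimately show False using no_low_distortion_embedding[OF \<alpha> _ C(1)] by linarith
  qed
  thus "\<exists>n::nat. 1 \<le> n \<and> (\<forall>\<alpha> :: nat rel. \<alpha> <o cardSuc natLeq \<longrightarrow>
      \<not> embeds_with_distortion (C_interval (ord_mult (omega_pow \<alpha>) (natLeq_on n)))
        (C_interval (ord_mult (omega_pow \<alpha>) (natLeq_on m))) D)"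
    by (intro exI[of _ "m + 2"]) simp
qed

end
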